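(* Let $n\ge2$ and put $$c_n=\begin{cases}1/\sqrt n,& n\text{ even},\\ 1/\sqrt{n-1},& n\text{ odd}.\end{cases}$$ Then for every simplex $SA_1\ldots A_n$ in $\mathbb R^n$, $$c_n\Theta\le\max_L|\Delta(L)|\le\sqrt{\frac{n-1}{n}}\;\Theta,$$ where the maximum is over all lines $L$ through $S$. Both constants are best possible: for each $n$, $c_n$ cannot be replaced by a larger constant and $\sqrt{(n-1)/n}$ cannot be replaced by a smaller constant in the inequality for all simplices in $\mathbb R^n$.
   Context: For a simplex $SA_1\ldots A_n$ in Euclidean space $\mathbb R^n$ let $\theta_{ij}$ be the angle between the edges $SA_i$ and $SA_j$ at $S$, and define $$\Theta=\Bigl(\sum_{i\ne j}\cos^2\theta_{ij}\Bigr)^{1/2},$$ the sum being over all ordered pairs $(i,j)$ with $1\le i,j\le n$, $i\neq j$. For a line $L$ through $S$ define $$\Delta(L)=\sum_{i=1}^{n}\frac{SH_i^2}{SA_i^2}-1,$$ where $H_i$ is the orthogonal projection of $A_i$ onto $L$. For points $X,Y$, $XY$ denotes their Euclidean distance. *)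

theory Defs
  imports "HOL-Analysis.Analysis"
begin

text \<open>
  A simplex \<open>S A\<^sub>1 \<dots> A\<^sub>n\<close> is given by its vertex \<open>S\<close> and the family \<open>A\<close> of its other
  vertices.  For a simplex in \<open>real ^ 'n\<close> the family is indexed by \<open>'n\<close> itself, so that it has
  exactly \<open>n = CARD('n)\<close> members.
\<close>

definition is_simplex :: "'a::euclidean_space \<Rightarrow> ('i::finite \<Rightarrow> 'a) \<Rightarrow> bool" where
  "is_simplex S A \<longleftrightarrow>
     inj A \<and> S \<notin> range A \<and> \<not> affine_dependent (insert S (range A))"

definition angle_at :: "'a::euclidean_space \<Rightarrow> 'a \<Rightarrow> 'a \<Rightarrow> real" where
  "angle_at S X Y = arccos (((X - S) \<bullet> (Y - S)) / (norm (X - S) * norm (Y - S)))"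

definition Theta :: "'a::euclidean_space \<Rightarrow> ('i::finite \<Rightarrow> 'a) \<Rightarrow> real" where
  "Theta S A = sqrt (\<Sum>(i, j) \<in> {(i, j). i \<noteq> j}. (cos (angle_at S (A i) (A j)))\<^sup>2)"

definition lines_through :: "'a::euclidean_space \<Rightarrow> 'a set set" where
  "lines_through S = {L. affine L \<and> aff_dim L = 1 \<and> S \<in> L}"

definition orth_proj :: "'a::euclidean_space set \<Rightarrow> 'a \<Rightarrow> 'a" where
  "orth_proj L X = (THE H. H \<in> L \<and> (\<forall>Y\<in>L. orthogonal (X - H) (Y - H)))"

definition Delta :: "'a::euclidean_space \<Rightarrow> ('i::finite \<Rightarrow> 'a) \<Rightarrow> 'a set \<Rightarrow> real" where
  "Delta S A L = (\<Sum>i\<in>UNIV. (dist S (orth_proj L (A i)))\<^sup>2 / (dist S (A i))\<^sup>2) - 1"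

text \<open>
  \<open>GREATEST\<close> denotes the maximum only if one is attained; attainment therefore has to be
  asserted separately wherever this constant is used.
\<close>

definition max_abs_Delta :: "'a::euclidean_space \<Rightarrow> ('i::finite \<Rightarrow> 'a) \<Rightarrow> real" where
  "max_abs_Delta S A = (GREATEST m. m \<in> (\<lambda>L. \<bar>Delta S A L\<bar>) ` lines_through S)"

definition lower_const :: "nat \<Rightarrow> real" where
  "lower_const n = (if even n then 1 / sqrt (real n) else 1 / sqrt (real n - 1))"

definition upper_const :: "nat \<Rightarrow> real" where
  "upper_const n = sqrt ((real n - 1) / real n)"

end

theory Submission
  imports Defs
begin

text \<open>
  Let \<open>u\<^sub>i\<close> be the unit vector from \<open>S\<close> towards \<open>A\<^sub>i\<close>.  For the line \<open>L\<close> spanned by a unit vector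
  \<open>x\<close>, \<open>\<Delta>(L) = \<Sum>\<^sub>i (u\<^sub>i \<bullet> x)\<^sup>2 - 1\<close> is the value at \<open>x\<close> of the quadratic form of the self-adjoint map
  \<open>M = \<Sum>\<^sub>i u\<^sub>i u\<^sub>i\<^sup>T - I\<close>.  There are as many \<open>u\<^sub>i\<close> as dimensions, so \<open>M\<close> has trace zero; and its squared
  Frobenius norm is \<open>\<Sum>\<^sub>i\<^sub>j (u\<^sub>i \<bullet> u\<^sub>j)\<^sup>2 - n\<close>, which is \<open>\<Theta>\<^sup>2\<close> because the diagonal terms equal 1.
  In terms of the eigenvalues \<open>l\<^sub>b\<close> of \<open>M\<close> this says \<open>\<Sum> l\<^sub>b = 0\<close>, \<open>\<Sum> l\<^sub>b\<^sup>2 = \<Theta>\<^sup>2\<close>, and the maximum of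
  \<open>\<bar>\<Delta>\<bar>\<close> is attained on an eigenline and equals \<open>m = max \<bar>l\<^sub>b\<bar>\<close> (\<open>Delta_spectrum\<close>).

  Only an inequality about \<open>n\<close> reals with sum zero remains.  If \<open>l\<^sub>k\<close> is one of them, it is minus the
  sum of the others, and Cauchy--Schwarz gives \<open>l\<^sub>k\<^sup>2 \<le> (n-1) \<Sum>\<^bsub>b \<noteq> k\<^esub> l\<^sub>b\<^sup>2\<close>: the upper bound
  (\<open>sum_zero_square_le\<close>).  For the lower bound, \<open>\<Sum> l\<^sub>b\<^sup>2 \<le> m \<Sum> \<bar>l\<^sub>b\<bar>\<close>, and the positive and the
  negative part of \<open>\<Sum> \<bar>l\<^sub>b\<bar>\<close> are equal, so each is at most \<open>m\<close> times the size of the smaller of the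
  two sign classes, hence at most \<open>m (n div 2)\<close> (\<open>sum_zero_sum_squares_le\<close>).  The dependence of \<open>c\<^sub>n\<close>
  on the parity of \<open>n\<close> comes from this integer part: \<open>c\<^sub>n = 1 / sqrt (2 (n div 2))\<close>.

  Equality holds above when one eigenvalue balances \<open>n - 1\<close> equal ones, which happens when all the
  \<open>u\<^sub>i \<bullet> u\<^sub>j\<close> with \<open>i \<noteq> j\<close> are equal and positive.  Equality holds below when the spectrum consists of
  pairs \<open>\<plusminus>t\<close> and at most one zero, which happens when the edges come in pairs that enclose a common
  acute angle and span mutually orthogonal planes, with one further edge orthogonal to all the others
  if \<open>n\<close> is odd.
\<close>

section \<open>Orthonormal eigenbases of self-adjoint maps\<close>

text \<open>
  A maximum point \<open>v\<close> of the quadratic form on the unit sphere of \<open>V\<close>, with value \<open>l\<close>, is an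
  eigenvector: moving from \<open>v\<close> along the residue \<open>r = f v - l v\<close> raises \<open>f x \<bullet> x - l (x \<bullet> x)\<close>, which is
  zero at \<open>v\<close> and nonpositive on \<open>V\<close>, at the first-order rate \<open>2 (r \<bullet> r)\<close>, so \<open>r = 0\<close>.
\<close>

lemma selfadjoint_eigenvector_exists:
  fixes f :: "'a::euclidean_space \<Rightarrow> 'a"
  assumes lin: "linear f" and sa: "\<And>x y. f x \<bullet> y = x \<bullet> f y"
    and V: "subspace V" and inv: "f ` V \<subseteq> V" and ne: "V \<noteq> {0}"
  obtains v l where "v \<in> V" "norm v = 1" "f v = l *\<^sub>R v"
proof -
  let ?K = "V \<inter> sphere 0 1"
  obtain w where w: "w \<in> V" "w \<noteq> 0"
    using ne V subspace_0 by blast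
  have "(inverse (norm w)) *\<^sub>R w \<in> ?K"
    using w V by (simp add: subspace_scale)
  then have K_ne: "?K \<noteq> {}" by blast
  have K_comp: "compact ?K"
    using closed_Int_compact[OF closed_subspace[OF V] compact_sphere] .
  have "continuous_on ?K (\<lambda>x. f x \<bullet> x)"
    by (intro continuous_on_inner linear_continuous_on continuous_on_id linear_conv_bounded_linear[THEN iffD1] lin)
  then obtain v where v: "v \<in> ?K" and vmax: "\<And>x. x \<in> ?K \<Longrightarrow> f x \<bullet> x \<le> f v \<bullet> v"
    using continuous_attains_sup[OF K_comp K_ne] by blast
  define l where "l = f v \<bullet> v"
  have nv: "norm v = 1" and vV: "v \<in> V" using v by auto
  have bound: "f x \<bullet> x \<le> l * (x \<bullet> x)" if x: "x \<in> V" for x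
  proof (cases "x = 0")
    case False
    let ?y = "inverse (norm x) *\<^sub>R x"
    have "?y \<in> ?K" using x False V by (simp add: subspace_scale)
    then have "f ?y \<bullet> ?y \<le> l" using vmax l_def by blast
    then have "f x \<bullet> x / (norm x)\<^sup>2 \<le> l"
      by (simp add: linear_cmul[OF lin] power2_eq_square inverse_eq_divide)
    then show ?thesis using False
      by (simp add: divide_le_eq power2_norm_eq_inner)
  qed simp
  define r where "r = f v - l *\<^sub>R v"
  define c where "c = f r \<bullet> r - l * (r \<bullet> r)"
  have rV: "r \<in> V"
    unfolding r_def using inv vV V by (intro subspace_diff subspace_scale) auto
  have first_order: "2 * (r \<bullet> r) + t * c \<le> 0" if t: "t > 0" for t
  proof -
    have "f (v + t *\<^sub>R r) \<bullet> (v + t *\<^sub>R r) \<le> l * ((v + t *\<^sub>R r) \<bullet> (v + t *\<^sub>R r))"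
      by (intro bound subspace_add subspace_scale V vV rV)
    moreover have "f (v + t *\<^sub>R r) \<bullet> (v + t *\<^sub>R r) - l * ((v + t *\<^sub>R r) \<bullet> (v + t *\<^sub>R r))
        = 2 * t * (f v \<bullet> r - l * (v \<bullet> r)) + t * t * c"
    proof -
      have e: "f r \<bullet> v = f v \<bullet> r" using sa[of r v] by (simp add: inner_commute)
      have e2: "v \<bullet> v = 1" using nv by (simp add: norm_eq_1)
      show ?thesis
        by (simp add: linear_add[OF lin] linear_cmul[OF lin] inner_add_left inner_add_right
            e e2 c_def l_def[symmetric] inner_commute[of r v] algebra_simps)
    qed
    moreover have "f v \<bullet> r - l * (v \<bullet> r) = r \<bullet> r"
      by (metis inner_diff_left inner_scaleR_left r_def)
    ultimately have "t * (2 * (r \<bullet> r) + t * c) \<le> 0" by (simp add: algebra_simps)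
    then show ?thesis using t by (simp add: mult_le_0_iff)
  qed
  have "r \<bullet> r = 0"
  proof (rule ccontr)
    assume "r \<bullet> r \<noteq> 0"
    then have pos: "r \<bullet> r > 0" by (simp add: inner_gt_zero_iff)
    \<comment> \<open>so small a step that the second-order term cannot compensate the first-order gain\<close>
    let ?t = "(r \<bullet> r) / (\<bar>c\<bar> + 1)"
    have "?t * \<bar>c\<bar> \<le> r \<bullet> r" using pos by (simp add: divide_le_eq field_simps)
    moreover have t: "?t > 0" using pos by (simp add: add_nonneg_pos)
    moreover have "?t * - \<bar>c\<bar> \<le> ?t * c" by (rule mult_left_mono) (use t in auto)
    ultimately show False using first_order[OF t] pos by (simp only: mult_minus_right)
  qed
  then have "f v = l *\<^sub>R v" by (simp add: r_def)
  then show thesis using that vV nv by blast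
qed

text \<open>
  The orthogonal complement within \<open>V\<close> of an eigenvector is again invariant, by self-adjointness, and
  of smaller dimension.
\<close>

lemma selfadjoint_eigenbasis_subspace:
  fixes f :: "'a::euclidean_space \<Rightarrow> 'a"
  assumes lin: "linear f" and sa: "\<And>x y. f x \<bullet> y = x \<bullet> f y"
    and V: "subspace V" and inv: "f ` V \<subseteq> V"
  shows "\<exists>B\<subseteq>V. pairwise orthogonal B \<and> (\<forall>b\<in>B. norm b = 1) \<and> V \<subseteq> span B \<and>
           (\<forall>b\<in>B. \<exists>l. f b = l *\<^sub>R b)"
  using V inv
proof (induction "dim V" arbitrary: V rule: less_induct)
  case less
  show ?case
  proof (cases "V = {0}")
    case True
    then show ?thesis by (intro exI[of _ "{}"]) auto
  next
    case False
    obtain v l where v: "v \<in> V" "norm v = 1" "f v = l *\<^sub>R v"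
      using selfadjoint_eigenvector_exists[OF lin sa less.prems False] by blast
    have vv: "v \<bullet> v = 1" using v(2) by (simp add: norm_eq_1)
    define W where "W = V \<inter> {x. v \<bullet> x = 0}"
    have W: "subspace W"
      unfolding W_def by (intro subspace_inter less.prems subspace_hyperplane)
    have "f x \<in> W" if "x \<in> W" for x
      using that less.prems(2) sa[of v x] v(3) by (auto simp: W_def)
    then have Winv: "f ` W \<subseteq> W" by blast
    have "v \<notin> W" using vv by (simp add: W_def)
    moreover have "W \<subseteq> V" by (simp add: W_def)
    ultimately have "W \<subset> V" using v(1) by blast
    then have "dim W < dim V"
      using W less.prems(1) dim_psubset by (metis span_eq_iff)
    from less.hyps[OF this W Winv] obtain B where
      B: "B \<subseteq> W" "pairwise orthogonal B" "\<forall>b\<in>B. norm b = 1" "W \<subseteq> span B"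
         "\<forall>b\<in>B. \<exists>l. f b = l *\<^sub>R b" by blast
    have "x \<in> span (insert v B)" if x: "x \<in> V" for x
    proof -
      have "x - (v \<bullet> x) *\<^sub>R v \<in> W"
        using x v(1) less.prems(1) vv
        by (auto simp: W_def inner_diff_right intro: subspace_diff subspace_scale)
      then show ?thesis using B(4) span_breakdown_eq by blast
    qed
    moreover have "pairwise orthogonal (insert v B)"
      using B(1,2) by (auto simp: pairwise_insert W_def orthogonal_def inner_commute)
    ultimately show ?thesis
      using B v by (intro exI[of _ "insert v B"]) (auto simp: W_def)
  qed
qed

lemma selfadjoint_eigenbasis:
  fixes f :: "'a::euclidean_space \<Rightarrow> 'a"
  assumes lin: "linear f" and sa: "\<And>x y. f x \<bullet> y = x \<bullet> f y"
  obtains B l where "finite B" "card B = DIM('a)" "pairwise orthogonal B"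
    "\<And>b. b \<in> B \<Longrightarrow> norm b = 1" "span B = UNIV" "\<And>b. b \<in> B \<Longrightarrow> f b = l b *\<^sub>R b"
proof -
  obtain B where B: "pairwise orthogonal B" "\<forall>b\<in>B. norm b = 1" "UNIV \<subseteq> span B"
      "\<forall>b\<in>B. \<exists>l. f b = l *\<^sub>R b"
    using selfadjoint_eigenbasis_subspace[OF lin sa, of UNIV] by auto
  have ind: "independent B"
    using B(1,2) by (intro pairwise_orthogonal_independent) auto
  have "card B = DIM('a)"
    using basis_card_eq_dim[of B UNIV] B(3) ind by simp
  moreover obtain l where "\<forall>b\<in>B. f b = l b *\<^sub>R b" using B(4) by metis
  ultimately show thesis
    using that[of B l] B ind by (auto simp: independent_imp_finite)
qed

lemma Parseval_orthonormal:
  fixes x y :: "'a::euclidean_space"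
  assumes "finite B" "pairwise orthogonal B" "\<And>b. b \<in> B \<Longrightarrow> norm b = 1" "span B = UNIV"
  shows "(\<Sum>b\<in>B. (x \<bullet> b) * (y \<bullet> b)) = x \<bullet> y"
proof -
  have "x \<bullet> y = (\<Sum>b\<in>B. (x \<bullet> b) *\<^sub>R b) \<bullet> y"
    using orthonormal_basis_expand[of B x] assms by simp
  also have "\<dots> = (\<Sum>b\<in>B. (x \<bullet> b) * (y \<bullet> b))"
    unfolding inner_sum_left by (intro sum.cong) (simp_all add: inner_commute)
  finally show ?thesis ..
qed

section \<open>Real families with sum zero\<close>

lemma sum_zero_square_le:
  fixes l :: "'b \<Rightarrow> real"
  assumes fin: "finite B" and k: "k \<in> B" and zero: "sum l B = 0"
  shows "(l k)\<^sup>2 \<le> (real (card B) - 1) / real (card B) * (\<Sum>b\<in>B. (l b)\<^sup>2)"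
proof -
  let ?C = "B - {k}" and ?n = "real (card B)"
  have n: "?n > 0" using fin k card_gt_0_iff by force
  have "l k = - sum l ?C" using zero fin k by (simp add: sum.remove)
  then have "(l k)\<^sup>2 = (\<Sum>b\<in>?C. 1 * l b)\<^sup>2" by simp
  also have "\<dots> \<le> (\<Sum>b\<in>?C. 1\<^sup>2) * (\<Sum>b\<in>?C. (l b)\<^sup>2)"
    by (rule Cauchy_Schwarz_ineq_sum)
  also have "(\<Sum>b\<in>?C. 1\<^sup>2) = real (card ?C)" by simp
  also have "\<dots> = ?n - 1" using card.remove[OF fin k] by linarith
  also have "(\<Sum>b\<in>?C. (l b)\<^sup>2) = (\<Sum>b\<in>B. (l b)\<^sup>2) - (l k)\<^sup>2"
    using fin k by (simp add: sum.remove)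
  finally have "?n * (l k)\<^sup>2 \<le> (?n - 1) * (\<Sum>b\<in>B. (l b)\<^sup>2)"
    by (simp add: algebra_simps)
  then show ?thesis using n by (simp add: field_simps)
qed

text \<open>
  One of the two sign classes has at most half of the members, and it carries exactly half of
  \<open>\<Sum> \<bar>l b\<bar>\<close> because the sum vanishes.
\<close>

lemma sum_zero_sum_squares_le:
  fixes l :: "'b \<Rightarrow> real"
  assumes fin: "finite B" and zero: "sum l B = 0" and m: "\<And>b. b \<in> B \<Longrightarrow> \<bar>l b\<bar> \<le> m"
  shows "(\<Sum>b\<in>B. (l b)\<^sup>2) \<le> real (2 * (card B div 2)) * m\<^sup>2"
proof (cases "B = {}")
  case False
  then have m0: "m \<ge> 0" using m by fastforce
  define P N where "P = {b\<in>B. l b \<ge> 0}" and "N = {b\<in>B. l b < 0}"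
  have PN: "B = P \<union> N" "P \<inter> N = {}" "finite P" "finite N"
    using fin by (auto simp: P_def N_def)
  have split: "sum g B = sum g P + sum g N" for g :: "'b \<Rightarrow> real"
    using PN by (simp add: sum.union_disjoint)
  have absP: "(\<Sum>b\<in>P. \<bar>l b\<bar>) = sum l P" and absN: "(\<Sum>b\<in>N. \<bar>l b\<bar>) = - sum l N"
    by (auto simp: P_def N_def sum_negf[symmetric] intro!: sum.cong)
  have card_bound: "(\<Sum>b\<in>X. \<bar>l b\<bar>) \<le> real (card X) * m" if "X \<subseteq> B" for X
    using sum_bounded_above[of X "\<lambda>b. \<bar>l b\<bar>" m] m that by auto
  have eq: "sum l N = - sum l P" using split[of l] zero by simp
  have "card B = card P + card N" using PN by (simp add: card_Un_disjoint)
  then have "card P \<le> card B div 2 \<or> card N \<le> card B div 2" by linarith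
  moreover have "P \<subseteq> B" "(\<Sum>b\<in>B. \<bar>l b\<bar>) = 2 * (\<Sum>b\<in>P. \<bar>l b\<bar>)"
    "N \<subseteq> B" "(\<Sum>b\<in>B. \<bar>l b\<bar>) = 2 * (\<Sum>b\<in>N. \<bar>l b\<bar>)"
    unfolding split[of "\<lambda>b. \<bar>l b\<bar>"] absP absN eq by (auto simp: P_def N_def)
  ultimately obtain X
    where X: "X \<subseteq> B" "card X \<le> card B div 2" "(\<Sum>b\<in>B. \<bar>l b\<bar>) = 2 * (\<Sum>b\<in>X. \<bar>l b\<bar>)"
    by blast
  have "(\<Sum>b\<in>B. \<bar>l b\<bar>) \<le> 2 * (real (card B div 2) * m)"
    using X(3) card_bound[OF X(1)] mult_right_mono[of "real (card X)" "real (card B div 2)" m] X(2) m0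
    by linarith
  then have "m * (\<Sum>b\<in>B. \<bar>l b\<bar>) \<le> m * (2 * (real (card B div 2) * m))"
    using m0 mult_left_mono by blast
  moreover have "(\<Sum>b\<in>B. (l b)\<^sup>2) \<le> (\<Sum>b\<in>B. m * \<bar>l b\<bar>)"
  proof (rule sum_mono)
    fix b assume "b \<in> B"
    then show "(l b)\<^sup>2 \<le> m * \<bar>l b\<bar>"
      using mult_right_mono[OF m, of b "\<bar>l b\<bar>"] by (simp add: power2_eq_square)
  qed
  ultimately show ?thesis by (simp add: sum_distrib_left[symmetric] power2_eq_square algebra_simps)
qed simp

section \<open>Lines through a point and the frame of edge directions\<close>

definition line_along :: "'a::euclidean_space \<Rightarrow> 'a \<Rightarrow> 'a set" where
  "line_along S x = range (\<lambda>t. S + t *\<^sub>R x)"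

text \<open>
  The frame vectors \<open>u\<^sub>i\<close>, which carry all that \<open>\<Theta>\<close> and \<open>\<Delta>\<close> depend on.
\<close>

definition edge_dir :: "'a::euclidean_space \<Rightarrow> ('i \<Rightarrow> 'a) \<Rightarrow> 'i \<Rightarrow> 'a" where
  "edge_dir S A i = (A i - S) /\<^sub>R norm (A i - S)"

lemma norm_edge_dir:
  assumes "S \<notin> range A"
  shows "norm (edge_dir S A i) = 1"
proof -
  have "A i \<noteq> S" using assms by auto
  then show ?thesis by (simp add: edge_dir_def)
qed

lemma lines_through_eq: "lines_through S = line_along S ` {x. norm x = 1}"
proof (rule set_eqI, rule iffI)
  fix L assume "L \<in> lines_through S"
  then have L: "affine L" "aff_dim L = 1" "S \<in> L" by (auto simp: lines_through_def)
  have "L \<noteq> {S}" using L(2) by auto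
  then obtain a where a: "a \<in> L" "a \<noteq> S" using L(3) by blast
  let ?d = "a - S"
  have "affine hull {S, a} \<subseteq> L" using a L by (simp add: hull_minimal)
  moreover have "aff_dim (affine hull {S, a}) = aff_dim L" using a L by simp
  ultimately have "affine hull {S, a} = L"
    using L by (intro affine_dim_equal) auto
  then have "L = range (\<lambda>u. S + u *\<^sub>R ?d)" by (simp add: affine_hull_2_alt)
  also have "\<dots> = line_along S (?d /\<^sub>R norm ?d)"
  proof -
    have eq: "S + u *\<^sub>R ?d = S + (u * norm ?d) *\<^sub>R (?d /\<^sub>R norm ?d)"
      "S + u *\<^sub>R (?d /\<^sub>R norm ?d) = S + (u / norm ?d) *\<^sub>R ?d" for u
      using a by (simp_all add: inverse_eq_divide)
    show ?thesis
      unfolding line_along_def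
      by (intro equalityI image_subsetI; rule range_eqI; rule eq)
  qed
  finally show "L \<in> line_along S ` {x. norm x = 1}"
    using a by (intro image_eqI) auto
next
  fix L assume "L \<in> line_along S ` {x. norm x = 1}"
  then obtain x where x: "norm x = 1" "L = line_along S x" by blast
  have "L = affine hull {S, S + x}" using x by (simp add: line_along_def affine_hull_2_alt)
  moreover have "x \<noteq> 0" using x(1) by auto
  ultimately show "L \<in> lines_through S"
    by (auto simp: lines_through_def hull_inc)
qed

lemma orth_proj_line_along:
  assumes "norm x = 1"
  shows "orth_proj (line_along S x) X = S + ((X - S) \<bullet> x) *\<^sub>R x"
  unfolding orth_proj_def
proof (rule the_equality)
  have xx: "x \<bullet> x = 1" using assms by (simp add: norm_eq_1)
  let ?H = "S + ((X - S) \<bullet> x) *\<^sub>R x"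
  show H: "?H \<in> line_along S x \<and> (\<forall>Y\<in>line_along S x. orthogonal (X - ?H) (Y - ?H))"
  proof
    show "?H \<in> line_along S x" unfolding line_along_def by (rule rangeI)
    show "\<forall>Y\<in>line_along S x. orthogonal (X - ?H) (Y - ?H)"
      by (auto simp: line_along_def orthogonal_def xx inner_diff_left inner_diff_right inner_add_left
          inner_add_right algebra_simps)
  qed
  fix H' assume H': "H' \<in> line_along S x \<and> (\<forall>Y\<in>line_along S x. orthogonal (X - H') (Y - H'))"
  \<comment> \<open>each foot tests the other; the sum of the two relations is the squared distance of the feet\<close>
  have "(X - ?H) \<bullet> (H' - ?H) = 0" "(X - H') \<bullet> (?H - H') = 0"
    using H H' by (auto simp: orthogonal_def)
  then have "(?H - H') \<bullet> (?H - H') = 0" by (simp add: inner_diff algebra_simps inner_commute)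
  then show "H' = ?H" by simp
qed

lemma Delta_line_along:
  assumes "norm x = 1"
  shows "Delta S A (line_along S x) = (\<Sum>i\<in>UNIV. (edge_dir S A i \<bullet> x)\<^sup>2) - 1"
proof -
  have "(dist S (orth_proj (line_along S x) (A i)))\<^sup>2 / (dist S (A i))\<^sup>2 = (edge_dir S A i \<bullet> x)\<^sup>2" for i
    using assms
    by (simp add: orth_proj_line_along dist_norm norm_minus_commute edge_dir_def
        power_mult_distrib power_inverse divide_inverse mult.commute)
  then show ?thesis by (simp add: Delta_def)
qed

lemma Theta_squared:
  fixes A :: "'i::finite \<Rightarrow> 'a::euclidean_space"
  assumes "S \<notin> range A"
  shows "(Theta S A)\<^sup>2 = (\<Sum>i\<in>UNIV. \<Sum>j\<in>UNIV. (edge_dir S A i \<bullet> edge_dir S A j)\<^sup>2) - real CARD('i)"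
proof -
  let ?u = "edge_dir S A"
  have cos: "cos (angle_at S (A i) (A j)) = ?u i \<bullet> ?u j" for i j
  proof -
    have "\<bar>?u i \<bullet> ?u j\<bar> \<le> 1"
      using Cauchy_Schwarz_ineq2[of "?u i" "?u j"] norm_edge_dir[OF assms] by simp
    moreover have "((A i - S) \<bullet> (A j - S)) / (norm (A i - S) * norm (A j - S)) = ?u i \<bullet> ?u j"
      by (simp add: edge_dir_def inverse_eq_divide mult.commute)
    ultimately show ?thesis by (simp add: angle_at_def abs_le_iff)
  qed
  have diag: "?u i \<bullet> ?u i = 1" for i using norm_edge_dir[OF assms] by (simp add: norm_eq_1)
  let ?g = "\<lambda>(i, j). (?u i \<bullet> ?u j)\<^sup>2" and ?D = "(\<lambda>i. (i, i)) ` (UNIV :: 'i set)"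
  have "(Theta S A)\<^sup>2 = sum ?g {(i, j). i \<noteq> j}"
    by (simp add: Theta_def cos sum_nonneg case_prod_beta)
  also have "{(i, j). i \<noteq> j} = UNIV \<times> UNIV - ?D" by auto
  also have "sum ?g (UNIV \<times> UNIV - ?D) = sum ?g (UNIV \<times> UNIV) - sum ?g ?D"
    by (rule sum_diff) auto
  also have "sum ?g ?D = real CARD('i)"
    by (subst sum.reindex) (auto simp: inj_on_def diag)
  finally show ?thesis by (simp add: sum.cartesian_product)
qed

lemma max_abs_Delta_eqI:
  assumes "L0 \<in> lines_through S" "\<And>L. L \<in> lines_through S \<Longrightarrow> \<bar>Delta S A L\<bar> \<le> \<bar>Delta S A L0\<bar>"
  shows "max_abs_Delta S A = \<bar>Delta S A L0\<bar>"
  unfolding max_abs_Delta_def using assms by (intro Greatest_equality) auto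

section \<open>The spectrum of the frame\<close>

text \<open>
  The numbers \<open>l b\<close> are the eigenvalues of \<open>M = \<Sum>\<^sub>i u\<^sub>i u\<^sub>i\<^sup>T - I\<close> and \<open>B\<close> is an orthonormal eigenbasis.
  Both traces, of \<open>M\<close> and of \<open>M\<^sup>2\<close>, are computed over \<open>B\<close> and converted by Parseval's identity into
  sums over the frame; equality of \<open>CARD('i)\<close> with the dimension is what makes the trace of \<open>M\<close> zero.
\<close>

lemma Delta_spectrum:
  fixes A :: "'i::finite \<Rightarrow> 'a::euclidean_space"
  assumes S: "S \<notin> range A" and card: "CARD('i) = DIM('a)"
  obtains B l where "finite B" "card B = DIM('a)" "pairwise orthogonal B"
    "\<And>b. b \<in> B \<Longrightarrow> norm b = 1" "span B = UNIV"
    "sum l B = 0" "(\<Sum>b\<in>B. (l b)\<^sup>2) = (Theta S A)\<^sup>2"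
    "\<And>x. norm x = 1 \<Longrightarrow> Delta S A (line_along S x) = (\<Sum>b\<in>B. l b * (x \<bullet> b)\<^sup>2)"
proof -
  define u where "u = edge_dir S A"
  define f where "f x = (\<Sum>i\<in>UNIV. (u i \<bullet> x) *\<^sub>R u i) - x" for x
  have lin: "linear f"
    by (rule linearI)
       (simp_all add: f_def inner_add_right scaleR_add_left sum.distrib scaleR_sum_right algebra_simps)
  have inner_f: "f x \<bullet> y = (\<Sum>i\<in>UNIV. (u i \<bullet> x) * (u i \<bullet> y)) - x \<bullet> y" for x y
    by (simp add: f_def inner_diff_left inner_sum_left)
  have sa: "f x \<bullet> y = x \<bullet> f y" for x y
    using inner_f[of x y] inner_f[of y x] by (simp add: inner_commute mult.commute)
  obtain B l where B: "finite B" "card B = DIM('a)" "pairwise orthogonal B"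
      "\<And>b. b \<in> B \<Longrightarrow> norm b = 1" "span B = UNIV" and l: "\<And>b. b \<in> B \<Longrightarrow> f b = l b *\<^sub>R b"
    using selfadjoint_eigenbasis[OF lin sa] by metis
  note parseval = Parseval_orthonormal[OF B(1) B(3) B(4) B(5)]
  have uu: "u i \<bullet> u i = 1" for i using norm_edge_dir[OF S] by (simp add: u_def norm_eq_1)
  have bb: "b \<bullet> b = 1" if "b \<in> B" for b using B(4)[OF that] by (simp add: norm_eq_1)
  have trace: "(\<Sum>b\<in>B. f b \<bullet> g b) = (\<Sum>i\<in>UNIV. \<Sum>b\<in>B. (u i \<bullet> b) * (u i \<bullet> g b)) - (\<Sum>b\<in>B. b \<bullet> g b)" for g
    by (simp add: inner_f sum_subtractf sum.swap[of _ B])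
  have lb: "l b = f b \<bullet> b" if "b \<in> B" for b using l[OF that] bb[OF that] by simp
  \<comment> \<open>the case \<open>g b = b\<close> yields the trace of \<open>M\<close>, the case \<open>g = f\<close> that of \<open>M\<^sup>2\<close>\<close>
  have "sum l B = (\<Sum>b\<in>B. f b \<bullet> b)" by (simp add: lb)
  also have "\<dots> = 0" using trace[of "\<lambda>b. b"] by (simp add: parseval uu bb B(2) card)
  finally have sum0: "sum l B = 0" .
  then have tr0: "(\<Sum>b\<in>B. f b \<bullet> b) = 0" by (simp add: lb)
  have parseval_f: "(\<Sum>b\<in>B. (u i \<bullet> b) * (f (u i) \<bullet> b)) = f (u i) \<bullet> u i" for i
    unfolding inner_commute[of "f (u i)" "u i"] by (rule parseval)
  have "(\<Sum>b\<in>B. (l b)\<^sup>2) = (\<Sum>b\<in>B. f b \<bullet> f b)"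
    using l bb by (intro sum.cong) (auto simp: power2_eq_square)
  also have "\<dots> = (\<Sum>i\<in>UNIV. \<Sum>b\<in>B. (u i \<bullet> b) * (f (u i) \<bullet> b)) - (\<Sum>b\<in>B. f b \<bullet> b)"
    using trace[of f] by (simp add: sa inner_commute)
  also have "\<dots> = (\<Sum>i\<in>UNIV. f (u i) \<bullet> u i)"
    unfolding tr0 using parseval_f by simp
  also have "\<dots> = (\<Sum>i\<in>UNIV. \<Sum>j\<in>UNIV. (u i \<bullet> u j)\<^sup>2) - real CARD('i)"
    by (simp add: inner_f sum_subtractf uu power2_eq_square inner_commute[of "u _" "u _"])
  also have "\<dots> = (Theta S A)\<^sup>2" using Theta_squared[OF S] by (simp add: u_def)
  finally have sumsq: "(\<Sum>b\<in>B. (l b)\<^sup>2) = (Theta S A)\<^sup>2" .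
  have Delta: "Delta S A (line_along S x) = (\<Sum>b\<in>B. l b * (x \<bullet> b)\<^sup>2)" if x: "norm x = 1" for x
  proof -
    have "Delta S A (line_along S x) = f x \<bullet> x"
      using x by (simp add: Delta_line_along inner_f u_def power2_eq_square norm_eq_1)
    also have "\<dots> = (\<Sum>b\<in>B. (f x \<bullet> b) * (x \<bullet> b))" by (rule parseval[symmetric])
    also have "\<dots> = (\<Sum>b\<in>B. l b * (x \<bullet> b)\<^sup>2)"
      using l by (intro sum.cong) (auto simp: sa power2_eq_square)
    finally show ?thesis .
  qed
  show thesis using that[OF B sum0 sumsq Delta] .
qed

lemma lower_const_eq: "lower_const n = 1 / sqrt (real (2 * (n div 2)))"
  by (cases "even n") (auto simp: lower_const_def elim!: evenE oddE)

text \<open>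
  For a unit vector \<open>x\<close> the squares \<open>(x \<bullet> b)\<^sup>2\<close> sum to 1, so \<open>\<Delta>\<close> is an average of the eigenvalues with
  these weights; its absolute value is therefore largest on the line of an eigenvector \<open>k\<close> with
  \<open>\<bar>l k\<bar>\<close> maximal.
\<close>

lemma max_abs_Delta_bounds:
  fixes A :: "'i::finite \<Rightarrow> 'a::euclidean_space"
  assumes S: "S \<notin> range A" and card: "CARD('i) = DIM('a)"
  shows "\<exists>L0\<in>lines_through S. \<forall>L\<in>lines_through S. \<bar>Delta S A L\<bar> \<le> \<bar>Delta S A L0\<bar>"
    and "lower_const CARD('i) * Theta S A \<le> max_abs_Delta S A"
    and "max_abs_Delta S A \<le> upper_const CARD('i) * Theta S A"
proof -
  obtain B l where B: "finite B" "card B = DIM('a)" "pairwise orthogonal B"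
      "\<And>b. b \<in> B \<Longrightarrow> norm b = 1" "span B = UNIV"
    and l: "sum l B = 0" "(\<Sum>b\<in>B. (l b)\<^sup>2) = (Theta S A)\<^sup>2"
    and Delta: "\<And>x. norm x = 1 \<Longrightarrow> Delta S A (line_along S x) = (\<Sum>b\<in>B. l b * (x \<bullet> b)\<^sup>2)"
    by (rule Delta_spectrum[OF S card]) (rule that)
  have Bne: "B \<noteq> {}" using B(2) by auto
  define m where "m = Max ((\<lambda>b. \<bar>l b\<bar>) ` B)"
  have m: "\<bar>l b\<bar> \<le> m" if "b \<in> B" for b using that B(1) by (simp add: m_def)
  have "m \<in> (\<lambda>b. \<bar>l b\<bar>) ` B" unfolding m_def using B(1) Bne by (intro Max_in) auto
  then obtain k where k: "k \<in> B" "m = \<bar>l k\<bar>" by blast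
  let ?L0 = "line_along S k"
  have "Delta S A ?L0 = (\<Sum>b\<in>B. if b = k then l k else 0)"
    unfolding Delta[OF B(4)[OF k(1)]]
  proof (rule sum.cong)
    fix b assume "b \<in> B"
    then show "l b * (k \<bullet> b)\<^sup>2 = (if b = k then l k else 0)"
      using B(3,4) k(1) by (auto simp: pairwise_def orthogonal_def norm_eq_1)
  qed simp
  then have DL0: "\<bar>Delta S A ?L0\<bar> = m" using k B(1) by simp
  have bound: "\<bar>Delta S A L\<bar> \<le> m" if L: "L \<in> lines_through S" for L
  proof -
    obtain x where x: "norm x = 1" "L = line_along S x" using L by (auto simp: lines_through_eq)
    have "\<bar>Delta S A L\<bar> \<le> (\<Sum>b\<in>B. \<bar>l b\<bar> * (x \<bullet> b)\<^sup>2)"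
      unfolding x(2) Delta[OF x(1)] by (rule order.trans[OF sum_abs]) (simp add: abs_mult)
    also have "\<dots> \<le> (\<Sum>b\<in>B. m * (x \<bullet> b)\<^sup>2)" by (intro sum_mono mult_right_mono m) auto
    also have "\<dots> = m * (\<Sum>b\<in>B. (x \<bullet> b) * (x \<bullet> b))"
      by (simp add: sum_distrib_left power2_eq_square)
    also have "\<dots> = m" using x(1) Parseval_orthonormal[OF B(1,3,4,5)] by (simp add: norm_eq_1)
    finally show ?thesis .
  qed
  have L0: "?L0 \<in> lines_through S" using B(4) k by (auto simp: lines_through_eq)
  show "\<exists>L0\<in>lines_through S. \<forall>L\<in>lines_through S. \<bar>Delta S A L\<bar> \<le> \<bar>Delta S A L0\<bar>"
    using L0 DL0 bound by (intro bexI[of _ ?L0]) auto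
  have max: "max_abs_Delta S A = m"
    using max_abs_Delta_eqI[OF L0] DL0 bound by auto
  have Th0: "Theta S A \<ge> 0" by (simp add: Theta_def sum_nonneg case_prod_beta)
  have m0: "m \<ge> 0" using k by simp
  have "(Theta S A)\<^sup>2 \<le> real (2 * (CARD('i) div 2)) * m\<^sup>2"
    using sum_zero_sum_squares_le[OF B(1) l(1) m] by (simp add: l(2) B(2) card)
  then have "Theta S A \<le> sqrt (real (2 * (CARD('i) div 2)) * m\<^sup>2)"
    by (rule real_le_rsqrt)
  then have "Theta S A \<le> sqrt (real (2 * (CARD('i) div 2))) * m"
    using m0 by (simp only: real_sqrt_mult real_sqrt_abs abs_of_nonneg)
  then show "lower_const CARD('i) * Theta S A \<le> max_abs_Delta S A"
    unfolding max lower_const_eq using m0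
    by (cases "CARD('i) div 2 = 0") (auto simp: divide_le_eq mult.commute)
  have "m\<^sup>2 \<le> (real CARD('i) - 1) / real CARD('i) * (Theta S A)\<^sup>2"
    using sum_zero_square_le[OF B(1) k(1) l(1)] k(2) by (simp add: l(2) B(2) card)
  then have "m \<le> sqrt ((real CARD('i) - 1) / real CARD('i) * (Theta S A)\<^sup>2)"
    by (rule real_le_rsqrt)
  then have "m \<le> sqrt ((real CARD('i) - 1) / real CARD('i)) * Theta S A"
    using Th0 by (simp only: real_sqrt_mult real_sqrt_abs abs_of_nonneg)
  then show "max_abs_Delta S A \<le> upper_const CARD('i) * Theta S A"
    unfolding max upper_const_def .
qed

lemma max_abs_Delta_attained:
  fixes A :: "'i::finite \<Rightarrow> 'a::euclidean_space"
  assumes "S \<notin> range A" "CARD('i) = DIM('a)"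
  obtains L0 where "L0 \<in> lines_through S" "max_abs_Delta S A = \<bar>Delta S A L0\<bar>"
  using max_abs_Delta_bounds(1)[OF assms] max_abs_Delta_eqI by metis

lemma abs_Delta_le_max:
  fixes A :: "'i::finite \<Rightarrow> 'a::euclidean_space"
  assumes "S \<notin> range A" "CARD('i) = DIM('a)" "L \<in> lines_through S"
  shows "\<bar>Delta S A L\<bar> \<le> max_abs_Delta S A"
  using max_abs_Delta_bounds(1)[OF assms(1,2)] max_abs_Delta_eqI assms(3) by metis

section \<open>Extremal simplices\<close>

text \<open>
  A spanning family with as many members as dimensions is a basis, and a basis together with the
  origin is a simplex.
\<close>

lemma is_simplex_zeroI:
  fixes A :: "'i::finite \<Rightarrow> 'a::euclidean_space"
  assumes card: "CARD('i) = DIM('a)" and span: "span (range A) = UNIV"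
  shows "is_simplex 0 A"
proof -
  have le: "card (range A) \<le> DIM('a)" using card_image_le[of UNIV A] card by simp
  have ind: "independent (range A)"
    by (rule card_le_dim_spanning[of _ UNIV]) (use span le in auto)
  have "card (range A) = DIM('a)" using basis_card_eq_dim[of "range A" UNIV] span ind by simp
  then have "inj A" using card by (simp add: eq_card_imp_inj_on)
  moreover have zero: "0 \<notin> range A" using ind dependent_zero by blast
  moreover have "\<not> affine_dependent (insert 0 (range A))"
    using ind affine_dependent_iff_dependent[OF zero] by simp
  ultimately show ?thesis by (simp add: is_simplex_def)
qed

text \<open>
  All pairs of edges enclose the same acute angle, with cosine \<open>t = (n+2)/(n+3)\<close>.  The line along the
  all-ones vector, the axis of symmetry, attains the bound: there \<open>\<Delta> = (n-1) t\<close>, while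
  \<open>\<Theta>\<^sup>2 = n (n-1) t\<^sup>2\<close>.
\<close>

lemma upper_const_attained:
  fixes A :: "'n::finite \<Rightarrow> real ^ 'n"
  assumes n: "CARD('n) \<ge> 2" and A: "A = (\<lambda>i. axis i 1 + 1)"
  shows "is_simplex 0 A" "Theta 0 A > 0" "max_abs_Delta 0 A \<ge> upper_const CARD('n) * Theta 0 A"
proof -
  let ?n = "real CARD('n)"
  have n_ge: "?n \<ge> 1" using n by simp
  have Abasis: "axis i 1 = A i - 1" for i by (simp add: A)
  have one: "(1::real^'n) = (1 / (?n + 1)) *\<^sub>R (\<Sum>i\<in>UNIV. A i)"
    by (simp add: vec_eq_iff A axis_def sum.distrib of_nat_index)
  have one': "(1::real^'n) \<in> span (range A)"
    by (subst one) (intro span_scale span_sum span_base, auto)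
  have "axis i 1 \<in> span (range A)" for i
    unfolding Abasis by (intro span_diff span_base one') auto
  then have "span Basis \<subseteq> span (range A)"
    by (intro span_minimal) (auto simp: Basis_vec_def)
  then show simplex: "is_simplex 0 A" by (intro is_simplex_zeroI) auto
  then have zero: "0 \<notin> range A" by (simp add: is_simplex_def)
  have one_one: "(1 :: real^'n) \<bullet> 1 = ?n" by (simp add: inner_vec_def)
  have AA: "A i \<bullet> A j = (if i = j then ?n + 3 else ?n + 2)" for i j
    by (auto simp: A inner_add_left inner_add_right inner_axis inner_axis' one_one) (auto simp: axis_def)
  have norm_A: "norm (A i) = sqrt (?n + 3)" for i by (simp add: norm_eq_sqrt_inner AA)
  define t where "t = (?n + 2) / (?n + 3)"
  have t: "t > 0" by (simp add: t_def add_pos_pos)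
  have uu: "(edge_dir 0 A i \<bullet> edge_dir 0 A j)\<^sup>2 = t\<^sup>2 + (if i = j then 1 - t\<^sup>2 else 0)" for i j
  proof -
    have "edge_dir 0 A i \<bullet> edge_dir 0 A j = (A i \<bullet> A j) / (sqrt (?n + 3) * sqrt (?n + 3))"
      by (simp add: edge_dir_def norm_A inverse_eq_divide)
    also have "\<dots> = (if i = j then 1 else t)" by (simp add: AA t_def)
    finally show ?thesis by simp
  qed
  have "(Theta 0 A)\<^sup>2 = ?n * (?n - 1) * t\<^sup>2"
    unfolding Theta_squared[OF zero] uu by (simp add: sum.distrib algebra_simps)
  moreover have "Theta 0 A \<ge> 0" by (simp add: Theta_def sum_nonneg case_prod_beta)
  ultimately have Theta: "Theta 0 A = sqrt (?n * (?n - 1)) * t"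
    using t by (intro power2_eq_imp_eq[where y = "sqrt (?n * (?n - 1)) * t"]) (auto simp: power_mult_distrib n_ge)
  show "Theta 0 A > 0" unfolding Theta using n t by simp
  let ?x = "(1 / sqrt ?n) *\<^sub>R (1 :: real^'n)"
  have x: "norm ?x = 1" by (simp add: norm_eq_sqrt_inner inner_vec_def)
  have "(edge_dir 0 A i \<bullet> ?x)\<^sup>2 = (?n + 1)\<^sup>2 / (?n * (?n + 3))" for i
  proof -
    have "A i \<bullet> 1 = ?n + 1" by (simp add: A inner_vec_def axis_def sum.distrib)
    then show ?thesis
      by (simp add: edge_dir_def norm_A power_mult_distrib power_divide divide_inverse power_inverse)
  qed
  then have "Delta 0 A (line_along 0 ?x) = (?n + 1)\<^sup>2 / (?n + 3) - 1"
    by (simp add: Delta_line_along[OF x])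
  also have "\<dots> = (?n - 1) * t"
    unfolding t_def by (simp add: divide_simps power2_eq_square) (simp add: algebra_simps)
  finally have D: "Delta 0 A (line_along 0 ?x) = (?n - 1) * t" .
  have "upper_const CARD('n) * Theta 0 A = sqrt ((?n - 1) * (?n - 1)) * t"
    by (simp add: upper_const_def Theta real_sqrt_mult[symmetric] del: real_sqrt_mult_self)
  also have "\<dots> = (?n - 1) * t" using n by simp
  also have "\<dots> \<le> \<bar>Delta 0 A (line_along 0 ?x)\<bar>" by (simp add: D)
  also have "\<dots> \<le> max_abs_Delta 0 A"
    using x by (intro abs_Delta_le_max zero) (auto simp: lines_through_eq)
  finally show "max_abs_Delta 0 A \<ge> upper_const CARD('n) * Theta 0 A" .
qed

text \<open>
  Remove two elements, pair the rest by induction, and let the involution swap the two.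
\<close>

lemma maximal_pairing_exists:
  assumes "finite A"
  shows "\<exists>\<sigma>. (\<forall>i. \<sigma> (\<sigma> i) = i) \<and> {i. \<sigma> i \<noteq> i} \<subseteq> A \<and> card {i. \<sigma> i \<noteq> i} = 2 * (card A div 2)"
  using assms
proof (induction "card A" arbitrary: A rule: less_induct)
  case less
  show ?case
  proof (cases "card A < 2")
    case True
    then show ?thesis by (intro exI[of _ id]) auto
  next
    case False
    then obtain a b where ab: "a \<in> A" "b \<in> A" "a \<noteq> b"
      using card_le_Suc0_iff_eq[OF less.prems] by fastforce
    let ?A = "A - {a, b}"
    have card: "card A = card ?A + 2"
      using ab less.prems False by (simp add: card_Diff_subset)
    obtain \<sigma> where s: "\<forall>i. \<sigma> (\<sigma> i) = i" "{i. \<sigma> i \<noteq> i} \<subseteq> ?A"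
        "card {i. \<sigma> i \<noteq> i} = 2 * (card ?A div 2)"
      using less.hyps[of ?A] card less.prems by auto
    let ?\<tau> = "\<sigma>(a := b, b := a)"
    have fix_ab: "\<sigma> a = a" "\<sigma> b = b" using s(2) by auto
    have "\<sigma> i \<noteq> a" "\<sigma> i \<noteq> b" if "i \<noteq> a" "i \<noteq> b" for i
      using that s(1) fix_ab by metis+
    then have "\<forall>i. ?\<tau> (?\<tau> i) = i" using s(1) by auto
    moreover have nonfixed: "{i. ?\<tau> i \<noteq> i} = insert a (insert b {i. \<sigma> i \<noteq> i})"
      using ab(3) by auto
    moreover have "card {i. ?\<tau> i \<noteq> i} = 2 * (card A div 2)"
      unfolding nonfixed using ab(3) fix_ab s(3) card finite_subset[OF s(2)] less.prems
      by (simp add: card_insert_if)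
    ultimately show ?thesis using s(2) ab by (intro exI[of _ ?\<tau>]) auto
  qed
qed

text \<open>
  The vectors \<open>2 e\<^sub>i + e\<^bsub>\<sigma> i\<^esub>\<close> and \<open>e\<^sub>i + 2 e\<^bsub>\<sigma> i\<^esub>\<close> of a pair span a coordinate plane and enclose an angle
  with cosine \<open>4/5\<close>; an unpaired index contributes a vector orthogonal to all others.  The form \<open>\<Delta>\<close>
  becomes \<open>4/5 \<Sum> x\<^sub>i x\<^bsub>\<sigma> i\<^esub>\<close> over the paired indices, with eigenvalues \<open>\<plusminus>4/5\<close> on each plane, whereas
  \<open>\<Theta>\<^sup>2\<close> is \<open>(4/5)\<^sup>2\<close> times the number of paired indices.
\<close>

lemma lower_const_attained:
  fixes A :: "'n::finite \<Rightarrow> real ^ 'n"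
  assumes n: "CARD('n) \<ge> 2" and inv: "\<And>i. \<sigma> (\<sigma> i) = i"
    and N: "card {i. \<sigma> i \<noteq> i} = 2 * (CARD('n) div 2)"
    and A: "A = (\<lambda>i. 2 *\<^sub>R axis i 1 + axis (\<sigma> i) 1)"
  shows "is_simplex 0 A" "Theta 0 A > 0" "max_abs_Delta 0 A \<le> lower_const CARD('n) * Theta 0 A"
proof -
  let ?N = "{i. \<sigma> i \<noteq> i}"
  have Abasis: "axis i 1 = (1/3) *\<^sub>R (2 *\<^sub>R A i - A (\<sigma> i))" for i
    by (simp add: A inv vec_eq_iff)
  have "axis i 1 \<in> span (range A)" for i
    unfolding Abasis by (intro span_diff span_base span_scale) auto
  then have "span Basis \<subseteq> span (range A)"
    by (intro span_minimal) (auto simp: Basis_vec_def)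
  then show simplex: "is_simplex 0 A" by (intro is_simplex_zeroI) auto
  then have zero: "0 \<notin> range A" by (simp add: is_simplex_def)
  have \<sigma>_eq: "\<sigma> i = \<sigma> j \<longleftrightarrow> i = j" "\<sigma> i = j \<longleftrightarrow> i = \<sigma> j" for i j using inv by metis+
  have Ax: "A i \<bullet> x = 2 * x $ i + x $ \<sigma> i" for i x
    by (simp add: A inner_add_left inner_axis')
  have AA: "A i \<bullet> A j = (if i = j then 5 else 0) + (if i = \<sigma> j then 4 else 0)" for i j
    by (auto simp: Ax) (auto simp: A axis_def \<sigma>_eq inv)
  have norm_A: "norm (A i) = (if \<sigma> i = i then 3 else sqrt 5)" for i
    by (auto simp: norm_eq_sqrt_inner AA)
  have uu: "(edge_dir 0 A i \<bullet> edge_dir 0 A j)\<^sup>2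
      = (if j = i then 1 else 0) + (if j = \<sigma> i then if \<sigma> i \<noteq> i then 16/25 else 0 else 0)" for i j
    by (auto simp: edge_dir_def AA norm_A inv power_mult_distrib power2_eq_square field_simps)
  have "(Theta 0 A)\<^sup>2 = (\<Sum>i\<in>UNIV. if \<sigma> i \<noteq> i then 16/25 else 0)"
    unfolding Theta_squared[OF zero] uu by (simp add: sum.distrib)
  also have "\<dots> = real (card ?N) * (4/5)\<^sup>2"
    by (simp add: sum.If_cases power2_eq_square)
  finally have "(Theta 0 A)\<^sup>2 = real (card ?N) * (4/5)\<^sup>2" .
  moreover have "Theta 0 A \<ge> 0" by (simp add: Theta_def sum_nonneg case_prod_beta)
  ultimately have Theta: "Theta 0 A = sqrt (real (card ?N)) * (4/5)"
    by (intro power2_eq_imp_eq[where y = "sqrt (real (card ?N)) * (4/5)"])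
       (simp_all only: power_mult_distrib real_sqrt_pow2 of_nat_0_le_iff mult_nonneg_nonneg real_sqrt_ge_zero zero_le_divide_iff zero_le_numeral simp_thms)
  have Npos: "card ?N > 0" unfolding N using n by simp
  then have sqrt_pos: "sqrt (real (card ?N)) > 0" by (simp only: real_sqrt_gt_0_iff of_nat_0_less_iff)
  from sqrt_pos show "Theta 0 A > 0" unfolding Theta by (rule mult_pos_pos) simp
  have bound: "\<bar>Delta 0 A (line_along 0 x)\<bar> \<le> 4/5" if x: "norm x = 1" for x
  proof -
    have sum_x: "(\<Sum>i\<in>UNIV. (x $ i)\<^sup>2) = 1"
      using x by (simp add: norm_eq_1 inner_vec_def power2_eq_square)
    have swap: "(\<Sum>i\<in>?N. (x $ \<sigma> i)\<^sup>2) = (\<Sum>i\<in>?N. (x $ i)\<^sup>2)"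
      by (rule sum.reindex_bij_witness[of _ \<sigma> \<sigma>]) (auto simp: inv \<sigma>_eq)
    have summand: "(edge_dir 0 A i \<bullet> x)\<^sup>2 - (x $ i)\<^sup>2
        = (if \<sigma> i \<noteq> i then 1/5 * (x $ \<sigma> i)\<^sup>2 - 1/5 * (x $ i)\<^sup>2 + 4/5 * (x $ i * x $ \<sigma> i) else 0)" for i
      by (auto simp: edge_dir_def Ax norm_A power_mult_distrib power_inverse field_simps power2_eq_square)
    have "Delta 0 A (line_along 0 x) = (\<Sum>i\<in>UNIV. (edge_dir 0 A i \<bullet> x)\<^sup>2 - (x $ i)\<^sup>2)"
      by (simp add: Delta_line_along[OF x] sum_subtractf sum_x)
    also have "\<dots> = (\<Sum>i\<in>?N. 1/5 * (x $ \<sigma> i)\<^sup>2 - 1/5 * (x $ i)\<^sup>2 + 4/5 * (x $ i * x $ \<sigma> i))"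
      unfolding summand by (simp add: sum.If_cases)
    also have "\<dots> = 4/5 * (\<Sum>i\<in>?N. x $ i * x $ \<sigma> i)"
      by (simp only: sum.distrib sum_subtractf sum_distrib_left[symmetric] swap)
    finally have D: "\<bar>Delta 0 A (line_along 0 x)\<bar> = 4/5 * \<bar>\<Sum>i\<in>?N. x $ i * x $ \<sigma> i\<bar>"
      by (simp add: abs_mult)
    have "\<bar>\<Sum>i\<in>?N. x $ i * x $ \<sigma> i\<bar> \<le> (\<Sum>i\<in>?N. 1/2 * (x $ i)\<^sup>2 + 1/2 * (x $ \<sigma> i)\<^sup>2)"
    proof (rule order.trans[OF sum_abs], rule sum_mono)
      fix i
      show "\<bar>x $ i * x $ \<sigma> i\<bar> \<le> 1/2 * (x $ i)\<^sup>2 + 1/2 * (x $ \<sigma> i)\<^sup>2"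
        using sum_squares_bound[of "\<bar>x $ i\<bar>" "\<bar>x $ \<sigma> i\<bar>"] by (simp add: abs_mult)
    qed
    also have "\<dots> = (\<Sum>i\<in>?N. (x $ i)\<^sup>2)"
      by (simp only: sum.distrib sum_distrib_left[symmetric] swap)
    also have "\<dots> \<le> (\<Sum>i\<in>UNIV. (x $ i)\<^sup>2)" by (rule sum_mono2) auto
    finally show ?thesis unfolding D sum_x by simp
  qed
  obtain L where L: "L \<in> lines_through 0" "max_abs_Delta 0 A = \<bar>Delta 0 A L\<bar>"
    using max_abs_Delta_attained[OF zero] by auto
  then have "max_abs_Delta 0 A \<le> 4/5" using bound by (auto simp: lines_through_eq)
  also have "4/5 = lower_const CARD('n) * Theta 0 A"
    unfolding Theta lower_const_eq N[symmetric] using less_imp_neq[OF sqrt_pos]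
    by (simp only: times_divide_eq_left mult_1 nonzero_mult_div_cancel_left not_sym)
  finally show "max_abs_Delta 0 A \<le> lower_const CARD('n) * Theta 0 A" .
qed

theorem theorem5p3:
  assumes "CARD('n::finite) \<ge> 2"
  shows
    "(\<forall>(S :: real ^ 'n) (A :: 'n \<Rightarrow> real ^ 'n). is_simplex S A \<longrightarrow>
        (\<exists>L\<^sub>0 \<in> lines_through S. \<forall>L \<in> lines_through S. \<bar>Delta S A L\<bar> \<le> \<bar>Delta S A L\<^sub>0\<bar>) \<and>
        lower_const CARD('n) * Theta S A \<le> max_abs_Delta S A \<and>
        max_abs_Delta S A \<le> upper_const CARD('n) * Theta S A) \<and>
     (\<forall>c > lower_const CARD('n).
        \<exists>(S :: real ^ 'n) (A :: 'n \<Rightarrow> real ^ 'n). is_simplex S A \<and>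
          \<not> c * Theta S A \<le> max_abs_Delta S A) \<and>
     (\<forall>c < upper_const CARD('n).
        \<exists>(S :: real ^ 'n) (A :: 'n \<Rightarrow> real ^ 'n). is_simplex S A \<and>
          \<not> max_abs_Delta S A \<le> c * Theta S A)"
proof (intro conjI allI impI)
  fix S :: "real ^ 'n" and A :: "'n \<Rightarrow> real ^ 'n"
  assume "is_simplex S A"
  then have S: "S \<notin> range A" by (simp add: is_simplex_def)
  show "\<exists>L\<^sub>0 \<in> lines_through S. \<forall>L \<in> lines_through S. \<bar>Delta S A L\<bar> \<le> \<bar>Delta S A L\<^sub>0\<bar>"
    and "lower_const CARD('n) * Theta S A \<le> max_abs_Delta S A"
    and "max_abs_Delta S A \<le> upper_const CARD('n) * Theta S A"
    by (rule max_abs_Delta_bounds[OF S]; simp)+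
next
  fix c assume c: "c > lower_const CARD('n)"
  obtain \<sigma> :: "'n \<Rightarrow> 'n" where s: "\<And>i. \<sigma> (\<sigma> i) = i" "card {i. \<sigma> i \<noteq> i} = 2 * (CARD('n) div 2)"
    using maximal_pairing_exists[of "UNIV :: 'n set"] by auto
  define A :: "'n \<Rightarrow> real ^ 'n" where "A = (\<lambda>i. 2 *\<^sub>R axis i 1 + axis (\<sigma> i) 1)"
  note ex = lower_const_attained[OF assms s A_def]
  have "lower_const CARD('n) * Theta 0 A < c * Theta 0 A"
    using c ex(2) by (rule mult_strict_right_mono)
  then show "\<exists>(S :: real ^ 'n) (A :: 'n \<Rightarrow> real ^ 'n). is_simplex S A \<and> \<not> c * Theta S A \<le> max_abs_Delta S A"
    using ex(1,3) by (intro exI[of _ 0] exI[of _ A]) auto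
next
  fix c assume c: "c < upper_const CARD('n)"
  define A :: "'n \<Rightarrow> real ^ 'n" where "A = (\<lambda>i. axis i 1 + 1)"
  note ex = upper_const_attained[OF assms A_def]
  have "c * Theta 0 A < upper_const CARD('n) * Theta 0 A"
    using c ex(2) by (rule mult_strict_right_mono)
  then show "\<exists>(S :: real ^ 'n) (A :: 'n \<Rightarrow> real ^ 'n). is_simplex S A \<and> \<not> max_abs_Delta S A \<le> c * Theta S A"
    using ex(1,3) by (intro exI[of _ 0] exI[of _ A]) auto
qed

end
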